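(* Let $p\in\mathcal{D}^{+}(\mathbb{R})$ be of degree $2$ or $3$. Then $\deg_{+}(p)=\max\{\mathrm{n}^{\uparrow}(p),\mathrm{n}^{\downarrow}(p)\}$. Moreover, let $p=(x+c)(x-\omega)(x-\overline{\omega})\in\mathbb{R}[x]$, where $\omega=r(\cos\varphi+\mathbf{i}\sin\varphi)$, $c,r>0$ and $\varphi\in(0,\pi/2)$. Put $n=\lceil \pi/\varphi\rceil$, $\varepsilon=n\varphi-\pi$ (so $0\leq\varepsilon<\varphi$) and $s=\min\{\frac{c}{r},\frac{r}{c}\}$. Then (i) $n\leq\deg_{+}(p)\leq n+1$; (ii) $\deg_{+}(p)=n$ if and only if $\sin(\varphi-\varepsilon)\leq s\cdot\sin\varepsilon+(-1)^{n+1}s^{n}\cdot\sin\varphi$.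
   Context: $\mathbb{R}^{+}$ is the set of non-negative real numbers and $\mathbb{R}^{+}[x]$ the set of real polynomials with all coefficients non-negative; $\mathbf{i}$ is the imaginary unit. $\mathcal{D}^{+}(\mathbb{R})=\{0\}\cup\{f\in\mathbb{R}[x] : f(a)>0 \text{ for all } a\in(0,\infty)\}$. For $0\neq p\in\mathbb{R}[x]$, $\deg_{+}(p)$ is the least possible degree of a non-zero polynomial in $\mathbb{R}^{+}[x]$ divisible by $p$ (and $\infty$ if none exists). Let $p=a_{d}x^{d}+\cdots+a_{0}\in\mathbb{R}[x]$ have degree $d\geq1$. The real sequences $(r_k)_{k\geq0}$ satisfying $a_{d}r_{k+d}+a_{d-1}r_{k+d-1}+\cdots+a_{0}r_{k}=0$ for all $k\in\mathbb{N}_{0}$ form a $d$-dimensional real vector space; choose a basis $(a^{(1)}_{i})_{i\ge0},\dots,(a^{(d)}_{i})_{i\ge0}$ of it and put $\mathbf{v}_{k}=(a^{(1)}_{k},\dots,a^{(d)}_{k})\in\mathbb{R}^{d}$ for $k\in\mathbb{N}_{0}$. Then $\mathbf{v}_{0},\dots,\mathbf{v}_{d-1}$ are linearly independent; let $\Phi(\mathbf{w})=\det(\mathbf{v}_{0},\dots,\mathbf{v}_{d-2},\mathbf{w})$ for $\mathbf{w}\in\mathbb{R}^{d}$. Define $$\mathrm{n}^{\uparrow}(p)=\min\{k\in\{d,d+1,\dots\} : \Phi(\mathbf{v}_{k-1})\Phi(\mathbf{v}_{k})\leq0\}\in\mathbb{N}\cup\{\infty\}$$ (with $\min\emptyset=\infty$);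 this does not depend on the choice of basis. Define $\mathrm{n}^{\downarrow}(p)=\mathrm{n}^{\uparrow}(\tilde{p})$, where $\tilde{p}(x)=x^{d}p(1/x)$ and $d=\deg(p)$. *)

theory Defs
  imports
    "HOL-Library.Function_Algebras"
    "HOL-Library.Extended_Nat"
    "HOL-Computational_Algebra.Polynomial"
    "Jordan_Normal_Form.Determinant"
begin

definition D_plus :: "real poly set" where
  "D_plus = insert 0 {f. \<forall>a>0. poly f a > 0}"

definition R_plus_poly :: "real poly set" where
  "R_plus_poly = {f. \<forall>i. coeff f i \<ge> 0}"

(* The infimum of the empty set of extended naturals is \<infinity>. *)
definition deg_plus :: "real poly \<Rightarrow> enat" where
  "deg_plus p = Inf {enat (degree q) | q. q \<in> R_plus_poly \<and> q \<noteq> 0 \<and> p dvd q}"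

interpretation seq: vector_space "\<lambda>(c::real) (r::nat \<Rightarrow> real) k. c * r k"
  by unfold_locales (auto simp: fun_eq_iff algebra_simps)

definition rec_space :: "real poly \<Rightarrow> (nat \<Rightarrow> real) set" where
  "rec_space p = {r. \<forall>k. (\<Sum>i\<le>degree p. coeff p i * r (k + i)) = 0}"

(* The sequences b 0, ..., b (d - 1), where d = degree p, form a basis; b j is irrelevant
   for j \<ge> d. *)
definition rec_basis :: "real poly \<Rightarrow> (nat \<Rightarrow> nat \<Rightarrow> real) \<Rightarrow> bool" where
  "rec_basis p b \<longleftrightarrow>
     inj_on b {..<degree p} \<and>
     seq.independent (b ` {..<degree p}) \<and>
     seq.span (b ` {..<degree p}) = rec_space p"

definition vvec :: "nat \<Rightarrow> (nat \<Rightarrow> nat \<Rightarrow> real) \<Rightarrow> nat \<Rightarrow> real vec" where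
  "vvec d b k = vec d (\<lambda>j. b j k)"

definition Phi :: "nat \<Rightarrow> (nat \<Rightarrow> nat \<Rightarrow> real) \<Rightarrow> real vec \<Rightarrow> real" where
  "Phi d b w = det (mat_of_cols d (map (vvec d b) [0..<d - 1] @ [w]))"

definition n_up_wrt :: "nat \<Rightarrow> (nat \<Rightarrow> nat \<Rightarrow> real) \<Rightarrow> enat" where
  "n_up_wrt d b =
     Inf {enat k | k. d \<le> k \<and> Phi d b (vvec d b (k - 1)) * Phi d b (vvec d b k) \<le> 0}"

(* The value does not depend on the basis chosen by SOME. The construction is meant for
   degree p \<ge> 1; constants get the value 0, a convention that is needed because the
   reversal of x ^ d is the constant 1. *)
definition n_up :: "real poly \<Rightarrow> enat" where
  "n_up p = (if degree p = 0 then 0 else n_up_wrt (degree p) (SOME b. rec_basis p b))"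

(* reflect_poly p is x ^ d * p (1 / x) with d = degree p; its degree is smaller than d
   if p has no constant term. *)
definition n_down :: "real poly \<Rightarrow> enat" where
  "n_down p = n_up (reflect_poly p)"

end

theory Submission
  imports Defs Complex_Main
begin

text \<open>Let \<open>u\<close> be the solution of the recurrence of \<open>p\<close> with initial values \<open>0, \<dots>, 0, 1\<close>. Since
  \<open>\<Phi>(v\<^sub>k)\<close> is proportional to \<open>u\<^sub>k\<close>, \<open>n\<^sup>\<up>(p)\<close> is the first index at which \<open>u\<close> stops being positive. If \<open>p\<close> divides
  \<open>q\<close>, then the sum of all \<open>q\<^sub>i u\<^sub>i\<close> vanishes, which is impossible for nonnegative \<open>q\<close> of degree less than
  \<open>n\<^sup>\<up>(p)\<close>; applied to the reversed polynomials this bounds \<open>n\<^sup>\<down>(p)\<close>, too. For the converse only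
  \<open>Q = x\<^sup>2 - 2 r cos \<phi> x + r\<^sup>2\<close> and \<open>(x + c) Q\<close> matter, and by reversal \<open>c \<le> r\<close> may be assumed. Then \<open>u\<^sub>k > 0\<close> for
  \<open>2 \<le> k < n\<close>, so \<open>n\<^sup>\<up> \<ge> n\<close>. If also \<open>u\<^sub>n > 0\<close>, then \<open>n\<^sup>\<up> \<ge> n + 1\<close>, and \<open>x + c\<close> times a nonnegative multiple of
  \<open>Q\<close> of degree \<open>n\<close> attains this bound. If \<open>u\<^sub>n \<le> 0\<close>, two nonnegative trinomial multiples of \<open>Q\<close> of degree at
  most \<open>n\<close> take values of opposite sign at \<open>- c\<close>, so a nonnegative combination of them is also divisible
  by \<open>x + c\<close>. Here \<open>n = \<lceil>\<pi> / \<phi>\<rceil>\<close>.\<close>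

subsection \<open>Linear recurrences\<close>

lemma sum_fun_apply: "(\<Sum>a\<in>A. f a) x = (\<Sum>a\<in>A. f a x)"
  for f :: "'a \<Rightarrow> 'b \<Rightarrow> 'c :: comm_monoid_add"
  by (induction A rule: infinite_finite_induct) auto

lemma subspace_rec_space: "seq.subspace (rec_space p)"
proof (rule seq.subspaceI)
  fix x y assume "x \<in> rec_space p" "y \<in> rec_space p"
  then show "x + y \<in> rec_space p"
    by (simp add: rec_space_def distrib_left sum.distrib)
next
  fix c x assume "x \<in> rec_space p"
  then show "(\<lambda>k. c * x k) \<in> rec_space p"
    by (simp add: rec_space_def mult.left_commute[of _ c] flip: sum_distrib_left)
qed (simp add: rec_space_def)

lemma rec_space_sum:
  assumes "\<And>a. a \<in> A \<Longrightarrow> f a \<in> rec_space p"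
  shows "(\<lambda>k. \<Sum>a\<in>A. w a * f a k) \<in> rec_space p"
proof -
  have "(\<Sum>a\<in>A. (\<lambda>k. w a * f a k)) \<in> rec_space p"
    by (intro seq.subspace_sum seq.subspace_scale subspace_rec_space assms)
  also have "(\<Sum>a\<in>A. (\<lambda>k. w a * f a k)) = (\<lambda>k. \<Sum>a\<in>A. w a * f a k)"
    by (simp add: fun_eq_iff sum_fun_apply)
  finally show ?thesis .
qed

lemma rec_space_shift: "u \<in> rec_space p \<Longrightarrow> (\<lambda>k. u (m + k)) \<in> rec_space p"
  by (simp add: rec_space_def flip: add.assoc)

lemma rec_space_iff:
  assumes "p \<noteq> 0"
  shows "u \<in> rec_space p \<longleftrightarrow>
    (\<forall>k. u (k + degree p) = - (\<Sum>i<degree p. coeff p i * u (k + i)) / lead_coeff p)"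
  using assms
  by (auto simp: rec_space_def field_simps add_eq_0_iff simp flip: lessThan_Suc_atMost)

lemma rec_space_eqI:
  assumes p: "p \<noteq> 0" and u: "u \<in> rec_space p" and w: "w \<in> rec_space p"
    and init: "\<And>i. i < degree p \<Longrightarrow> u i = w i"
  shows "u = w"
proof
  fix k show "u k = w k"
  proof (induction k rule: less_induct)
    case (less k)
    show ?case
    proof (cases "k < degree p")
      case False
      define m where "m = k - degree p"
      have k: "k = m + degree p"
        using False by (simp add: m_def)
      have "u (m + i) = w (m + i)" if "i < degree p" for i
        using less[of "m + i"] that k by simp
      then show ?thesis
        using u w by (simp add: rec_space_iff[OF p] k)
    qed (simp add: init)
  qed
qed

fun rec_ext :: "real poly \<Rightarrow> (nat \<Rightarrow> real) \<Rightarrow> nat \<Rightarrow> real" where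
  "rec_ext p c k = (if k < degree p then c k else
     - (\<Sum>i<degree p. coeff p i * rec_ext p c (k - degree p + i)) / lead_coeff p)"

declare rec_ext.simps [simp del]

lemma rec_ext_init: "k < degree p \<Longrightarrow> rec_ext p c k = c k"
  by (subst rec_ext.simps) simp

lemma rec_ext_in_rec_space: "p \<noteq> 0 \<Longrightarrow> rec_ext p c \<in> rec_space p"
  by (subst rec_space_iff, assumption, intro allI, subst rec_ext.simps) simp

text \<open>Existence gives the \<open>SOME\<close> in \<open>n_up\<close> its meaning. The
  solutions whose initial values are the unit vectors form a basis: the coefficient of
  \<open>b i\<close> in a combination is its value at index \<open>i\<close>.\<close>

lemma ex_rec_basis:
  assumes p: "p \<noteq> 0"
  shows "\<exists>b. rec_basis p b"
proof -
  define d where "d = degree p"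
  define b where "b j = rec_ext p (\<lambda>i. of_bool (i = j))" for j
  have b_init: "b j i = of_bool (i = j)" if "i < d" for i j
    using that by (simp add: b_def d_def rec_ext_init)
  have b_mem: "b j \<in> rec_space p" for j
    using p by (simp add: b_def rec_ext_in_rec_space)
  have inj: "inj_on b {..<d}"
  proof (rule inj_onI)
    fix i j assume ij: "i \<in> {..<d}" "j \<in> {..<d}" "b i = b j"
    have "b i i = b j i" by (simp only: ij(3))
    then have "of_bool (i = j) = (1 :: real)" using ij(1) by (simp add: b_init)
    then show "i = j" by simp
  qed
  have coord: "(\<Sum>v\<in>b ` {..<d}. f v * v i) = f (b i)" if "i < d" for f i
  proof -
    have "(\<Sum>v\<in>b ` {..<d}. f v * v i) = (\<Sum>j<d. f (b j) * b j i)"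
      by (simp add: sum.reindex[OF inj])
    also have "\<dots> = (\<Sum>j<d. if j = i then f (b i) else 0)"
      using that by (intro sum.cong) (auto simp: b_init)
    finally show ?thesis using that by simp
  qed
  have "seq.independent (b ` {..<d})"
  proof (rule seq.independent_if_scalars_zero)
    fix f v assume f: "(\<Sum>v\<in>b ` {..<d}. (\<lambda>k. f v * v k)) = 0" and v: "v \<in> b ` {..<d}"
    obtain i where i: "i < d" "v = b i" using v by auto
    show "f v = 0"
      using fun_cong[OF f, of i] coord[OF i(1), of f] i by (simp add: sum_fun_apply)
  qed simp
  moreover have "seq.span (b ` {..<d}) = rec_space p"
  proof (rule antisym)
    show "seq.span (b ` {..<d}) \<subseteq> rec_space p"
      by (intro seq.span_minimal subspace_rec_space) (auto simp: b_mem)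
  next
    show "rec_space p \<subseteq> seq.span (b ` {..<d})"
    proof
      fix u assume u: "u \<in> rec_space p"
      have "u = (\<lambda>k. \<Sum>j<d. u j * b j k)"
      proof (rule rec_space_eqI[OF p u])
        show "(\<lambda>k. \<Sum>j<d. u j * b j k) \<in> rec_space p"
          by (intro rec_space_sum b_mem)
        fix i assume "i < degree p"
        then have i: "i < d" by (simp add: d_def)
        have "(\<Sum>j<d. u j * b j i) = (\<Sum>j<d. if j = i then u i else 0)"
          using i by (intro sum.cong) (auto simp: b_init)
        then show "u i = (\<Sum>j<d. u j * b j i)" using i by simp
      qed
      also have "\<dots> = (\<Sum>j<d. (\<lambda>k. u j * b j k))"
        by (simp add: fun_eq_iff sum_fun_apply)
      also have "\<dots> \<in> seq.span (b ` {..<d})"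
        by (intro seq.span_sum seq.span_scale seq.span_base) auto
      finally show "u \<in> seq.span (b ` {..<d})" .
    qed
  qed
  ultimately show ?thesis
    using inj unfolding rec_basis_def d_def by blast
qed

lemma rec_basis_some: "p \<noteq> 0 \<Longrightarrow> rec_basis p (SOME b. rec_basis p b)"
  using ex_rec_basis by (rule someI_ex)

text \<open>Expanding along the last column, the only one that depends on \<open>k\<close>, makes
  \<open>\<Phi>(v\<^sub>k)\<close> a fixed linear combination of the basis sequences, hence again a
  solution.\<close>

lemma Phi_cofactor:
  assumes "d \<ge> 1"
  obtains w where "\<And>k. Phi d b (vvec d b k) = (\<Sum>i<d. w i * b i k)"
proof -
  define A where "A k = mat_of_cols d (map (vvec d b) [0..<d - 1] @ [vvec d b k])" for k
  have A: "A k \<in> carrier_mat d d" for k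
    using assms by (simp add: A_def mat_of_cols_def)
  have A_index: "A k $$ (i, j) = b i (if j < d - 1 then j else k)" if "i < d" "j < d" for i j k
    using that by (simp add: A_def mat_of_cols_index nth_append vvec_def)
  have dim: "dim_row (A k) = d" "dim_col (A k) = d" for k
    using A[of k] by (simp_all only: carrier_matD)
  have "mat_delete (A k) i (d - 1) = mat_delete (A 0) i (d - 1)" if "i < d" for i k
    by (intro eq_matI) (simp_all add: mat_delete_def dim A_index)
  then have cof: "cofactor (A k) i (d - 1) = cofactor (A 0) i (d - 1)" if "i < d" for i k
    unfolding cofactor_def using that by metis
  have "Phi d b (vvec d b k) = (\<Sum>i<d. cofactor (A 0) i (d - 1) * b i k)" for k
  proof -
    have "Phi d b (vvec d b k) = (\<Sum>i<d. A k $$ (i, d - 1) * cofactor (A k) i (d - 1))"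
      unfolding Phi_def A_def[symmetric] using assms by (intro laplace_expansion_column A) auto
    also have "\<dots> = (\<Sum>i<d. cofactor (A 0) i (d - 1) * b i k)"
    proof (rule sum.cong)
      fix i assume "i \<in> {..<d}"
      then show "A k $$ (i, d - 1) * cofactor (A k) i (d - 1) = cofactor (A 0) i (d - 1) * b i k"
        using assms cof[of i k] by (simp add: A_index)
    qed simp
    finally show ?thesis .
  qed
  then show ?thesis by (rule that)
qed

lemma Phi_vvec_eq_0:
  assumes "k < d - 1"
  shows "Phi d b (vvec d b k) = 0"
  unfolding Phi_def
proof (rule det_identical_columns)
  show "mat_of_cols d (map (vvec d b) [0..<d - 1] @ [vvec d b k]) \<in> carrier_mat d d"
    using assms by (simp add: mat_of_cols_def)
  show "k \<noteq> d - 1" "k < d" "d - 1 < d" using assms by auto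
  show "col (mat_of_cols d (map (vvec d b) [0..<d - 1] @ [vvec d b k])) k =
    col (mat_of_cols d (map (vvec d b) [0..<d - 1] @ [vvec d b k])) (d - 1)"
    using assms by (subst (1 2) col_mat_of_cols) (auto simp: nth_append vvec_def)
qed

text \<open>If the determinant vanished, a nontrivial combination of the basis sequences would have
  all initial values 0 and so be the zero sequence, against independence.\<close>

lemma Phi_vvec_neq_0:
  assumes p: "degree p \<ge> 1" and b: "rec_basis p b"
  shows "Phi (degree p) b (vvec (degree p) b (degree p - 1)) \<noteq> 0"
proof
  define d where "d = degree p"
  have d: "d \<ge> 1" using p by (simp add: d_def)
  define M where "M = mat d d (\<lambda>(j, k). b j k)"
  have M: "M \<in> carrier_mat d d" by (simp add: M_def)
  have "map (vvec d b) [0..<d - 1] @ [vvec d b (d - 1)] = map (vvec d b) [0..<d]"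
    using d upt_Suc_append[of 0 "d - 1"] by simp
  then have Phi: "Phi d b (vvec d b (d - 1)) = det M"
    unfolding Phi_def M_def
    by (intro arg_cong[where f = det] eq_matI) (auto simp: mat_of_cols_index vvec_def)
  assume "Phi (degree p) b (vvec (degree p) b (degree p - 1)) = 0"
  then have "det (transpose_mat M) = 0"
    using Phi M by (simp add: det_transpose d_def)
  then obtain w where w: "w \<in> carrier_vec d" "w \<noteq> 0\<^sub>v d" "transpose_mat M *\<^sub>v w = 0\<^sub>v d"
    using det_0_iff_vec_prod_zero[of "transpose_mat M" d] M by auto
  have b_mem: "b j \<in> rec_space p" if "j < d" for j
    using b seq.span_base[of "b j" "b ` {..<d}"] that by (auto simp: rec_basis_def d_def)
  have inj: "inj_on b {..<d}" using b by (simp add: rec_basis_def d_def)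
  have "(\<lambda>k. \<Sum>j<d. w $ j * b j k) = (\<lambda>k. 0)"
  proof (rule rec_space_eqI)
    show "p \<noteq> 0" using p by auto
    show "(\<lambda>k. \<Sum>j<d. w $ j * b j k) \<in> rec_space p"
      by (intro rec_space_sum b_mem) simp
    show "(\<lambda>k. 0) \<in> rec_space p" by (simp add: rec_space_def)
    fix k assume "k < degree p"
    then have k: "k < d" by (simp add: d_def)
    have "(transpose_mat M *\<^sub>v w) $ k = 0" using w k by simp
    then show "(\<Sum>j<d. w $ j * b j k) = 0"
      using k w(1) by (simp add: M_def scalar_prod_def mult.commute lessThan_atLeast0)
  qed
  \<comment> \<open>Independence concerns the set of sequences, so the coefficients are transported
    along the inverse of \<open>b\<close>.\<close>
  then have "(\<Sum>v\<in>b ` {..<d}. (\<lambda>k. w $ the_inv_into {..<d} b v * v k)) = 0"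
    by (simp add: sum.reindex[OF inj] fun_eq_iff sum_fun_apply the_inv_into_f_f[OF inj])
  then have "w $ the_inv_into {..<d} b v = 0" if "v \<in> b ` {..<d}" for v
    using b that
    by (intro seq.independentD[of "b ` {..<d}" "b ` {..<d}"]) (auto simp: rec_basis_def d_def)
  then have "w $ j = 0" if "j < d" for j
    using that the_inv_into_f_f[OF inj, of j] by force
  then have "w = 0\<^sub>v d" using w(1) by (intro eq_vecI) auto
  then show False using w(2) by simp
qed

text \<open>As functions of \<open>k\<close>, both \<open>\<Phi>(v\<^sub>k)\<close> and \<open>u\<close> are solutions that vanish below \<open>degree p - 1\<close>, so
  they are proportional.\<close>

lemma n_up_impulse:
  assumes p: "degree p \<ge> 1" and u: "u \<in> rec_space p"
    and zero: "\<And>i. i < degree p - 1 \<Longrightarrow> u i = 0" and nz: "u (degree p - 1) \<noteq> 0"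
  shows "n_up p = Inf {enat k | k. degree p \<le> k \<and> u (k - 1) * u k \<le> 0}"
proof -
  define d where "d = degree p"
  have p0: "p \<noteq> 0" using p by auto
  define b where "b = (SOME b. rec_basis p b)"
  have b: "rec_basis p b" unfolding b_def by (rule rec_basis_some[OF p0])
  define F where "F k = Phi d b (vvec d b k)" for k
  have b_mem: "b j \<in> rec_space p" if "j < d" for j
    using b seq.span_base[of "b j" "b ` {..<d}"] that by (auto simp: rec_basis_def d_def)
  obtain w where w: "\<And>k. F k = (\<Sum>i<d. w i * b i k)"
    unfolding F_def using Phi_cofactor[of d b] p d_def by metis
  have F_mem: "F \<in> rec_space p"
    unfolding w[abs_def] by (intro rec_space_sum b_mem) simp
  define K where "K = F (d - 1) / u (d - 1)"
  have K: "K \<noteq> 0"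
    using Phi_vvec_neq_0[OF p b] nz by (simp add: K_def F_def d_def)
  have F: "F = (\<lambda>k. K * u k)"
  proof (rule rec_space_eqI[OF p0 F_mem])
    show "(\<lambda>k. K * u k) \<in> rec_space p"
      using seq.subspace_scale[OF subspace_rec_space u] .
    fix i assume "i < degree p"
    then consider "i < d - 1" | "i = d - 1" unfolding d_def by linarith
    then show "F i = K * u i"
      using zero nz by cases (simp_all add: F_def Phi_vvec_eq_0 d_def K_def)
  qed
  have "F (k - 1) * F k \<le> 0 \<longleftrightarrow> u (k - 1) * u k \<le> 0" for k
  proof -
    have "F (k - 1) * F k = K\<^sup>2 * (u (k - 1) * u k)"
      by (simp add: F power2_eq_square)
    then show ?thesis using K by (simp add: mult_le_0_iff zero_le_mult_iff)
  qed
  then show ?thesis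
    using p by (simp add: n_up_def n_up_wrt_def b_def[symmetric] F_def d_def)
qed

text \<open>Turns positivity of an explicit solution into a lower bound: for
  \<open>degree p \<le> k < n\<close> both factors of \<open>u (k - 1) * u k\<close> lie in the
  positive range.\<close>

lemma le_n_up:
  assumes p: "degree p \<ge> 1" and u: "u \<in> rec_space p"
    and zero: "\<And>i. i < degree p - 1 \<Longrightarrow> u i = 0"
    and pos: "\<And>i. degree p - 1 \<le> i \<Longrightarrow> i < n \<Longrightarrow> u i > 0" and n: "degree p \<le> n"
  shows "enat n \<le> n_up p"
proof -
  have "u (degree p - 1) > 0" using pos n p by simp
  then have "n_up p = Inf {enat k | k. degree p \<le> k \<and> u (k - 1) * u k \<le> 0}"
    using p u zero by (intro n_up_impulse) auto
  also have "enat n \<le> \<dots>"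
  proof (rule Inf_greatest, clarify)
    fix k assume k: "degree p \<le> k" "u (k - 1) * u k \<le> 0"
    show "enat n \<le> enat k"
    proof (rule ccontr)
      assume "\<not> enat n \<le> enat k"
      then have "u (k - 1) * u k > 0"
        using k p by (intro mult_pos_pos pos) auto
      then show False using k by simp
    qed
  qed
  finally show ?thesis .
qed

text \<open>The linear functional \<open>x^i \<mapsto> u i\<close> kills every
  \<open>x^k * p\<close>, hence every multiple of \<open>p\<close>.\<close>

lemma rec_space_dvd_sum:
  assumes u: "u \<in> rec_space p" and "p dvd q"
  shows "(\<Sum>i\<le>degree q. coeff q i * u i) = 0"
proof -
  obtain g where q: "q = p * g" using assms(2) by (elim dvdE)
  \<comment> \<open>Claiming this for all large \<open>N\<close> frees the induction from the degree
    of \<open>p * g\<close>; multiplying \<open>g\<close> by \<open>x\<close> amounts to shifting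
    \<open>u\<close>.\<close>
  have "\<exists>M. \<forall>N\<ge>M. (\<Sum>i\<le>N. coeff (p * g) i * u i) = 0"
    using u
  proof (induction g arbitrary: u)
    case 0
    then show ?case by simp
  next
    case (pCons a g)
    obtain M where M: "\<And>N. N \<ge> M \<Longrightarrow> (\<Sum>i\<le>N. coeff (p * g) i * u (Suc i)) = 0"
      using pCons.IH[of "\<lambda>k. u (1 + k)"] rec_space_shift[OF pCons.prems, of 1] by auto
    show ?case
    proof (intro exI allI impI)
      fix N assume N: "N \<ge> max (Suc M) (degree p)"
      then obtain N' where N': "N = Suc N'" "N' \<ge> M" by (cases N) auto
      have "(\<Sum>i\<le>N. coeff p i * u i) = (\<Sum>i\<le>degree p. coeff p i * u i)"
        using N by (intro sum.mono_neutral_right) (auto simp: coeff_eq_0)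
      also have "\<dots> = 0" using pCons.prems by (auto simp: rec_space_def dest: spec[of _ 0])
      finally have 1: "(\<Sum>i\<le>N. coeff p i * u i) = 0" .
      have "(\<Sum>i\<le>N. coeff (pCons 0 (p * g)) i * u i) = 0"
        using M[OF N'(2)] unfolding N'(1) by (subst sum.atMost_Suc_shift) simp
      then show "(\<Sum>i\<le>N. coeff (p * pCons a g) i * u i) = 0"
        using 1 by (simp add: mult_pCons_right distrib_right sum.distrib mult.assoc
            flip: sum_distrib_left)
    qed
  qed
  then obtain M where M: "\<And>N. N \<ge> M \<Longrightarrow> (\<Sum>i\<le>N. coeff q i * u i) = 0"
    by (auto simp: q)
  have "(\<Sum>i\<le>degree q. coeff q i * u i) = (\<Sum>i\<le>max M (degree q). coeff q i * u i)"
    by (intro sum.mono_neutral_left) (auto simp: coeff_eq_0)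
  then show ?thesis using M by simp
qed

text \<open>The sums that define \<open>rec_space p\<close> are the functionals of shifted solutions
  of \<open>f\<close>, evaluated at the multiple \<open>p\<close>.\<close>

lemma rec_space_mono:
  assumes "f dvd p" "u \<in> rec_space f"
  shows "u \<in> rec_space p"
  unfolding rec_space_def
  using rec_space_dvd_sum[OF rec_space_shift[OF assms(2)] assms(1)] by simp

subsection \<open>General bounds\<close>

lemma deg_plus_le:
  "q \<in> R_plus_poly \<Longrightarrow> q \<noteq> 0 \<Longrightarrow> p dvd q \<Longrightarrow> deg_plus p \<le> enat (degree q)"
  unfolding deg_plus_def by (intro Inf_lower) auto

lemma le_deg_plusI:
  "(\<And>q. q \<in> R_plus_poly \<Longrightarrow> q \<noteq> 0 \<Longrightarrow> p dvd q \<Longrightarrow> x \<le> enat (degree q)) \<Longrightarrow> x \<le> deg_plus p"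
  unfolding deg_plus_def by (intro Inf_greatest) auto

lemma deg_plus_mono: "p dvd q \<Longrightarrow> deg_plus p \<le> deg_plus q"
  by (intro le_deg_plusI deg_plus_le) auto

lemma n_up_le_deg_plus:
  assumes p: "p \<noteq> 0"
  shows "n_up p \<le> deg_plus p"
proof (cases "degree p = 0")
  case True
  \<comment> \<open>Constants have \<open>n_up\<close> equal to 0 by convention.\<close>
  then show ?thesis by (simp add: n_up_def)
next
  case False
  define d where "d = degree p"
  define u where "u = rec_ext p (\<lambda>i. of_bool (i = d - 1))"
  have u: "u \<in> rec_space p" using p by (simp add: u_def rec_ext_in_rec_space)
  have init: "u i = of_bool (i = d - 1)" if "i < d" for i
    using that by (simp add: u_def d_def rec_ext_init)
  have n_up: "n_up p = Inf {enat k | k. degree p \<le> k \<and> u (k - 1) * u k \<le> 0}"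
    using False u by (intro n_up_impulse) (auto simp: init d_def)
  show ?thesis
  proof (rule le_deg_plusI)
    fix q assume q: "q \<in> R_plus_poly" "q \<noteq> 0" "p dvd q"
    define N where "N = degree q"
    have dN: "d \<le> N" using q by (simp add: d_def N_def dvd_imp_degree_le)
    have "\<exists>k. d \<le> k \<and> k \<le> N \<and> u (k - 1) * u k \<le> 0"
    proof (rule ccontr)
      assume neg: "\<not> (\<exists>k. d \<le> k \<and> k \<le> N \<and> u (k - 1) * u k \<le> 0)"
      \<comment> \<open>Since \<open>u (d - 1) = 1\<close>, positive products of neighbours pass
        positivity on from index to index.\<close>
      have pos: "u k > 0" if "d - 1 \<le> k" "k \<le> N" for k
        using that
      proof (induction k rule: dec_induct)
        case base
        then show ?case using init[of "d - 1"] False by (simp add: d_def)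
      next
        case (step k)
        then have "u k > 0" by simp
        moreover have "u k * u (Suc k) > 0"
          using neg step by (auto simp: not_le dest!: spec[of _ "Suc k"])
        ultimately show ?case by (simp add: zero_less_mult_iff)
      qed
      have "0 \<le> u i" if "i \<le> N" for i
        using pos[of i] init[of i] that by (cases "i < d") (auto intro: less_imp_le)
      then have "0 \<le> coeff q i * u i" if "i \<le> N" for i
        using q that by (simp add: R_plus_poly_def)
      \<comment> \<open>All terms are nonnegative and the top one is positive, so the sum cannot
        vanish.\<close>
      then have "coeff q N * u N \<le> (\<Sum>i\<le>N. coeff q i * u i)"
        by (intro member_le_sum) auto
      moreover have "coeff q N > 0"
        using q by (simp add: R_plus_poly_def N_def order.strict_iff_order)
      then have "coeff q N * u N > 0"
        using dN by (intro mult_pos_pos pos) auto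
      ultimately show False
        using rec_space_dvd_sum[OF u q(3)] by (simp add: N_def)
    qed
    then obtain k where k: "d \<le> k" "k \<le> N" "u (k - 1) * u k \<le> 0" by blast
    have "n_up p \<le> enat k"
      unfolding n_up using k by (intro Inf_lower) (auto simp: d_def)
    also have "\<dots> \<le> enat (degree q)" using k by (simp add: N_def)
    finally show "n_up p \<le> enat (degree q)" .
  qed
qed

text \<open>Reversal is multiplicative, keeps coefficients nonnegative and never raises the degree,
  so it carries nonnegative multiples of \<open>p\<close> to nonnegative multiples of its
  reversal.\<close>

lemma deg_plus_reflect_le: "deg_plus (reflect_poly p) \<le> deg_plus p"
proof (rule le_deg_plusI)
  fix q assume q: "q \<in> R_plus_poly" "q \<noteq> 0" "p dvd q"
  then have "deg_plus (reflect_poly p) \<le> enat (degree (reflect_poly q))"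
    by (intro deg_plus_le) (auto simp: R_plus_poly_def coeff_reflect_poly reflect_poly_mult
        elim!: dvdE)
  also have "\<dots> \<le> enat (degree q)" by (simp add: degree_reflect_poly_le)
  finally show "deg_plus (reflect_poly p) \<le> enat (degree q)" .
qed

text \<open>A nonzero constant term makes reversal an involution, which gives the opposite
  inequality.\<close>

lemma deg_plus_reflect:
  assumes "coeff p 0 \<noteq> 0"
  shows "deg_plus (reflect_poly p) = deg_plus p"
  using deg_plus_reflect_le[of p] deg_plus_reflect_le[of "reflect_poly p"] assms
  by (simp add: antisym)

lemma n_down_le_deg_plus: "p \<noteq> 0 \<Longrightarrow> n_down p \<le> deg_plus p"
  unfolding n_down_def
  using n_up_le_deg_plus[of "reflect_poly p"] deg_plus_reflect_le[of p] by simp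

lemma deg_plus_smult: "a \<noteq> 0 \<Longrightarrow> deg_plus (smult a p) = deg_plus p"
  by (simp add: deg_plus_def smult_dvd_iff)

text \<open>Both polynomials have the same solution space, hence the same bases, so
  \<open>SOME\<close> picks the same one.\<close>

lemma n_up_smult:
  assumes "a \<noteq> 0"
  shows "n_up (smult a p) = n_up p"
proof -
  have "rec_space (smult a p) = rec_space p"
    using assms by (simp add: rec_space_def mult.assoc flip: sum_distrib_left)
  then have "rec_basis (smult a p) = rec_basis p"
    using assms by (simp add: rec_basis_def fun_eq_iff)
  then show ?thesis using assms by (simp add: n_up_def)
qed

lemma n_down_smult: "a \<noteq> 0 \<Longrightarrow> n_down (smult a p) = n_down p"
  by (simp add: n_down_def reflect_poly_smult n_up_smult)

lemma degree_le_n_up: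
  assumes "degree p \<ge> 1"
  shows "enat (degree p) \<le> n_up p"
  using assms unfolding n_up_def n_up_wrt_def by (auto intro!: Inf_greatest)

text \<open>Here \<open>p\<close> is its own nonnegative multiple, and the search for
  \<open>n_up\<close> starts at \<open>degree p\<close>.\<close>

lemma deg_plus_R_plus_poly:
  assumes p: "p \<in> R_plus_poly" "degree p \<ge> 1"
  shows "deg_plus p = max (n_up p) (n_down p)"
proof -
  have "p \<noteq> 0" using p by auto
  then have "deg_plus p \<le> n_up p"
    using deg_plus_le[of p p] degree_le_n_up[of p] p by simp
  then show ?thesis
    using n_up_le_deg_plus n_down_le_deg_plus \<open>p \<noteq> 0\<close> by (simp add: antisym le_max_iff_disj)
qed

subsection \<open>Quadratic and cubic polynomials\<close>

text \<open>The monic quadratic whose roots are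
  \<open>\<omega> = r * (cos \<phi> + i * sin \<phi>)\<close> and its conjugate.\<close>

definition quad :: "real \<Rightarrow> real \<Rightarrow> real poly" where
  "quad r \<phi> = [:r\<^sup>2, - 2 * r * cos \<phi>, 1:]"

definition cubic :: "real \<Rightarrow> real \<Rightarrow> real \<Rightarrow> real poly" where
  "cubic c r \<phi> = [:c, 1:] * quad r \<phi>"

lemma degree_quad [simp]: "degree (quad r \<phi>) = 2"
  by (simp add: quad_def)

lemma quad_neq_0 [simp]: "quad r \<phi> \<noteq> 0"
  by (simp add: quad_def)

lemma degree_cubic [simp]: "degree (cubic c r \<phi>) = 3"
  unfolding cubic_def by (subst degree_mult_eq) auto

lemma cubic_neq_0 [simp]: "cubic c r \<phi> \<noteq> 0"
  unfolding cubic_def by (subst mult_eq_0_iff) simp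

lemma quad_dvd_cubic: "quad r \<phi> dvd cubic c r \<phi>"
  by (simp add: cubic_def del: mult_pCons_left)

lemma sin_add_two_step: "sin (\<theta> + 2 * \<phi>) = 2 * cos \<phi> * sin (\<theta> + \<phi>) - sin \<theta>" for \<theta> \<phi> :: real
proof -
  have "sin (\<theta> + 2 * \<phi>) + sin \<theta> = sin ((\<theta> + \<phi>) + \<phi>) + sin ((\<theta> + \<phi>) - \<phi>)"
    by (simp add: algebra_simps)
  also have "\<dots> = 2 * cos \<phi> * sin (\<theta> + \<phi>)"
    unfolding sin_add[of "\<theta> + \<phi>" \<phi>] sin_diff[of "\<theta> + \<phi>" \<phi>] by simp
  finally show ?thesis by simp
qed

text \<open>The sequence is the imaginary part of \<open>e^(i \<theta>) * \<omega>^k\<close>, where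
  \<omega> is a root of the quadratic; the phase \<theta> provides for shifted sines.\<close>

lemma sin_in_rec_space_quad: "(\<lambda>k. r ^ k * sin (real k * \<phi> + \<theta>)) \<in> rec_space (quad r \<phi>)"
proof -
  have "(\<Sum>i\<le>2. coeff (quad r \<phi>) i * (r ^ (k + i) * sin (real (k + i) * \<phi> + \<theta>))) = 0" for k
  proof -
    have 1: "real (k + 1) * \<phi> + \<theta> = (real k * \<phi> + \<theta>) + \<phi>"
      "real (k + 2) * \<phi> + \<theta> = (real k * \<phi> + \<theta>) + 2 * \<phi>"
      by (simp_all add: algebra_simps)
    have "(\<Sum>i\<le>2. coeff (quad r \<phi>) i * (r ^ (k + i) * sin (real (k + i) * \<phi> + \<theta>))) =
        r\<^sup>2 * (r ^ k * sin (real k * \<phi> + \<theta>))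
        + - 2 * r * cos \<phi> * (r ^ (k + 1) * sin (real (k + 1) * \<phi> + \<theta>))
        + r ^ (k + 2) * sin (real (k + 2) * \<phi> + \<theta>)"
      by (simp add: numeral_2_eq_2 quad_def algebra_simps)
    also have "\<dots> = 0"
      unfolding 1 sin_add_two_step by (simp add: algebra_simps power_add power2_eq_square)
    finally show ?thesis .
  qed
  then show ?thesis by (simp add: rec_space_def)
qed

lemma power_in_rec_space_linear: "(\<lambda>k. (- c) ^ k) \<in> rec_space [:c, 1:]"
  by (simp add: rec_space_def)

text \<open>With \<open>s = c / r\<close>, the sequence \<open>k \<mapsto> r\<^sup>k * cubic_sol s \<phi> k\<close> is, up to a constant factor, the solution
  with initial values 0, 0, 1; it is found by partial fractions of the generating function
  \<open>1 / ((1 + c x) (1 - 2 r cos \<phi> x + r\<^sup>2 x\<^sup>2))\<close>.\<close>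

definition cubic_sol :: "real \<Rightarrow> real \<Rightarrow> nat \<Rightarrow> real" where
  "cubic_sol s \<phi> k = sin ((real k - 1) * \<phi>) + s * sin (real k * \<phi>) + (- s) ^ k * sin \<phi>"

text \<open>Each of the three summands solves the recurrence of one factor,
  \<open>quad r \<phi>\<close> or \<open>x + c\<close>, and hence that of the product.\<close>

lemma cubic_sol_in_rec_space:
  assumes "r \<noteq> 0"
  shows "(\<lambda>k. r ^ k * cubic_sol (c / r) \<phi> k) \<in> rec_space (cubic c r \<phi>)"
proof -
  let ?R = "rec_space (cubic c r \<phi>)"
  have 1: "(\<lambda>k. r ^ k * sin (real k * \<phi> + \<theta>)) \<in> ?R" for \<theta>
    by (rule rec_space_mono[OF quad_dvd_cubic sin_in_rec_space_quad])
  have "(\<lambda>k. (- c) ^ k) \<in> ?R"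
    by (rule rec_space_mono[OF _ power_in_rec_space_linear]) (simp add: cubic_def del: mult_pCons_left)
  then have 2: "(\<lambda>k. sin \<phi> * (- c) ^ k) \<in> ?R"
    by (rule seq.subspace_scale[OF subspace_rec_space])
  have 3: "(\<lambda>k. c / r * (r ^ k * sin (real k * \<phi> + 0))) \<in> ?R"
    by (intro seq.subspace_scale[OF subspace_rec_space] 1)
  have "(\<lambda>k. r ^ k * sin (real k * \<phi> + - \<phi>)) + (\<lambda>k. c / r * (r ^ k * sin (real k * \<phi> + 0)))
      + (\<lambda>k. sin \<phi> * (- c) ^ k) \<in> ?R" (is "?u \<in> _")
    by (intro seq.subspace_add[OF subspace_rec_space] 1 2 3)
  also have "?u = (\<lambda>k. r ^ k * cubic_sol (c / r) \<phi> k)"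
  proof
    fix k
    have "r ^ k * (- (c / r)) ^ k = (- c) ^ k"
      using assms by (simp flip: power_mult_distrib)
    then show "?u k = r ^ k * cubic_sol (c / r) \<phi> k"
      by (simp add: cubic_sol_def algebra_simps)
  qed
  finally show ?thesis .
qed

text \<open>The trinomials \<open>trinom r \<phi> j (n - j)\<close>, \<open>0 < j < n\<close>, are the extreme rays of the cone of polynomials of
  degree at most \<open>n\<close> with nonnegative coefficients that are divisible by \<open>quad r \<phi>\<close>.\<close>

definition trinom :: "real \<Rightarrow> real \<Rightarrow> nat \<Rightarrow> nat \<Rightarrow> real poly" where
  "trinom r \<phi> j m = monom (r ^ (j + m) * sin (real m * \<phi>)) 0
     - monom (r ^ m * sin (real (j + m) * \<phi>)) j + monom (sin (real j * \<phi>)) (j + m)"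

text \<open>As functions of \<open>m\<close>, the coefficients at 1 and \<open>x^j\<close> satisfy
  the recurrence of \<open>quad r \<phi>\<close>; the top term leaves a multiple of
  \<open>quad r \<phi>\<close>.\<close>

lemma trinom_add_two_right:
  "trinom r \<phi> j (m + 2) = smult (2 * r * cos \<phi>) (trinom r \<phi> j (m + 1))
     - smult (r\<^sup>2) (trinom r \<phi> j m) + quad r \<phi> * monom (sin (real j * \<phi>)) (j + m)"
proof -
  have 1: "real (m + 2) * \<phi> = real m * \<phi> + 2 * \<phi>" "real (m + 1) * \<phi> = real m * \<phi> + \<phi>"
    "real (j + (m + 2)) * \<phi> = real (j + m) * \<phi> + 2 * \<phi>"
    "real (j + (m + 1)) * \<phi> = real (j + m) * \<phi> + \<phi>"
    by (simp_all add: algebra_simps)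
  have "poly (trinom r \<phi> j (m + 2)) x = poly (smult (2 * r * cos \<phi>) (trinom r \<phi> j (m + 1))
     - smult (r\<^sup>2) (trinom r \<phi> j m) + quad r \<phi> * monom (sin (real j * \<phi>)) (j + m)) x" for x
    unfolding trinom_def 1 sin_add_two_step
    by (simp add: poly_monom quad_def algebra_simps power_add power2_eq_square)
  then show ?thesis by (intro poly_eq_poly_eq_iff[THEN iffD1] ext)
qed

text \<open>The analogue in \<open>j\<close> for \<open>m = 1\<close>: the two upper terms cancel by
  the sine recurrence, and the constant terms leave a multiple of
  \<open>quad r \<phi>\<close>.\<close>

lemma trinom_one_add_two:
  "trinom r \<phi> (j + 2) 1 = [:0, 2 * cos \<phi>:] * trinom r \<phi> (j + 1) 1
     - [:0, 0, 1:] * trinom r \<phi> j 1 + smult (r ^ (j + 1) * sin \<phi>) (quad r \<phi>)"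
proof -
  have 1: "real (j + 2) * \<phi> = real j * \<phi> + 2 * \<phi>" "real (j + 1) * \<phi> = real j * \<phi> + \<phi>"
    "real (j + 2 + 1) * \<phi> = real j * \<phi> + \<phi> + 2 * \<phi>"
    "real (j + 1 + 1) * \<phi> = real j * \<phi> + \<phi> + \<phi>"
    "real 1 * \<phi> = \<phi>"
    by (simp_all add: algebra_simps)
  have "poly (trinom r \<phi> (j + 2) 1) x = poly ([:0, 2 * cos \<phi>:] * trinom r \<phi> (j + 1) 1
     - [:0, 0, 1:] * trinom r \<phi> j 1 + smult (r ^ (j + 1) * sin \<phi>) (quad r \<phi>)) x" for x
    unfolding trinom_def 1 sin_add_two_step
    by (simp add: poly_monom quad_def algebra_simps power_add power2_eq_square)
  then show ?thesis by (intro poly_eq_poly_eq_iff[THEN iffD1] ext)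
qed

text \<open>Induction on \<open>j\<close> for \<open>m = 1\<close>, then on \<open>m\<close>; each
  carries two consecutive cases because the recurrences have order two.\<close>

lemma quad_dvd_trinom: "quad r \<phi> dvd trinom r \<phi> j m"
proof -
  have one: "quad r \<phi> dvd trinom r \<phi> j 1 \<and> quad r \<phi> dvd trinom r \<phi> (j + 1) 1" for j
  proof (induction j)
    case 0
    have "trinom r \<phi> 0 1 = 0"
      by (simp add: trinom_def)
    moreover have "trinom r \<phi> 1 1 = smult (sin \<phi>) (quad r \<phi>)"
      by (simp add: trinom_def quad_def monom_altdef power2_eq_square sin_double[of \<phi>]
          mult.commute[of _ 2])
    ultimately show ?case by (simp add: dvd_smult)
  next
    case (Suc j)
    then have "quad r \<phi> dvd trinom r \<phi> (j + 2) 1"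
      unfolding trinom_one_add_two by (intro dvd_add dvd_diff dvd_mult dvd_smult) auto
    then show ?case using Suc by simp
  qed
  have "quad r \<phi> dvd trinom r \<phi> j m \<and> quad r \<phi> dvd trinom r \<phi> j (m + 1)"
  proof (induction m)
    case 0
    have "trinom r \<phi> j 0 = 0"
      by (simp add: trinom_def)
    then show ?case using one by simp
  next
    case (Suc m)
    then have "quad r \<phi> dvd trinom r \<phi> j (m + 2)"
      unfolding trinom_add_two_right by (intro dvd_add dvd_diff dvd_smult dvd_triv_left) auto
    then show ?case using Suc by simp
  qed
  then show ?thesis ..
qed

section \<open>Nonnegative coefficients and divisibility by the cubic\<close>

lemma R_plus_poly_add: "f \<in> R_plus_poly \<Longrightarrow> g \<in> R_plus_poly \<Longrightarrow> f + g \<in> R_plus_poly"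
  and R_plus_poly_smult: "a \<ge> 0 \<Longrightarrow> f \<in> R_plus_poly \<Longrightarrow> smult a f \<in> R_plus_poly"
  and R_plus_poly_mult: "f \<in> R_plus_poly \<Longrightarrow> g \<in> R_plus_poly \<Longrightarrow> f * g \<in> R_plus_poly"
  by (auto simp: R_plus_poly_def coeff_mult intro!: sum_nonneg)

lemma R_plus_poly_add_eq_0_iff:
  "f \<in> R_plus_poly \<Longrightarrow> g \<in> R_plus_poly \<Longrightarrow> f + g = 0 \<longleftrightarrow> f = 0 \<and> g = 0"
  by (auto simp: R_plus_poly_def poly_eq_iff add_nonneg_eq_0_iff)

lemma linear_in_R_plus_poly: "c \<ge> 0 \<Longrightarrow> [:c, 1:] \<in> R_plus_poly"
  by (auto simp: R_plus_poly_def coeff_pCons split: nat.splits)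

lemma poly_quad_minus:
  assumes "c \<ge> 0" "r > 0" "cos \<phi> > 0"
  shows "poly (quad r \<phi>) (- c) > 0"
proof -
  have "poly (quad r \<phi>) (- c) = r\<^sup>2 + 2 * (r * cos \<phi> * c) + c\<^sup>2"
    by (simp add: quad_def power2_eq_square algebra_simps)
  also have "\<dots> > 0"
    using assms by (intro add_pos_nonneg) auto
  finally show ?thesis .
qed

text \<open>As \<open>- c\<close> is not a root of the quadratic factor, the root of
  \<open>f\<close> at \<open>- c\<close> must come from the cofactor.\<close>

lemma cubic_dvdI:
  assumes "c \<ge> 0" "r > 0" "cos \<phi> > 0" "quad r \<phi> dvd f" "poly f (- c) = 0"
  shows "cubic c r \<phi> dvd f"
proof -
  obtain g where f: "f = quad r \<phi> * g" using assms(4) by (elim dvdE)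
  have "poly g (- c) = 0"
    using assms(5) poly_quad_minus[OF assms(1-3)] by (simp add: f)
  then have "[:c, 1:] dvd g" by (simp add: poly_eq_0_iff_dvd)
  then show ?thesis unfolding f cubic_def mult.commute[of "quad r \<phi>"]
    by (intro mult_dvd_mono) auto
qed

subsection \<open>Bounds in terms of the argument of the complex root\<close>

text \<open>The last two assumptions characterize \<open>n = \<lceil>pi / \<phi>\<rceil>\<close>:
  among the multiples of \<phi>, \<open>n * \<phi>\<close> is the first to reach \<pi>.\<close>

locale half_turn =
  fixes \<phi> :: real and n :: nat
  assumes phi: "0 < \<phi>" "\<phi> < pi / 2"
    and less_pi: "(real n - 1) * \<phi> < pi" and pi_le: "pi \<le> real n * \<phi>"
begin

lemma n_ge_3: "n \<ge> 3"
proof (rule ccontr)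
  assume "\<not> n \<ge> 3"
  then have "real n * \<phi> \<le> 2 * \<phi>" using phi by (intro mult_right_mono) auto
  then show False using pi_le phi by linarith
qed

lemma sin_phi_pos: "sin \<phi> > 0"
  using phi by (intro sin_gt_zero) auto

lemma cos_phi_pos: "cos \<phi> > 0"
  using phi by (intro cos_gt_zero) auto

lemma sin_pos:
  assumes "0 < j" "j < n"
  shows "sin (real j * \<phi>) > 0"
proof (rule sin_gt_zero)
  show "0 < real j * \<phi>" using assms phi by simp
  have "real j * \<phi> \<le> (real n - 1) * \<phi>" using assms phi by (intro mult_right_mono) auto
  then show "real j * \<phi> < pi" using less_pi by simp
qed

lemma sin_n_le_0: "sin (real n * \<phi>) \<le> 0"
proof -
  have "real n * \<phi> < pi + \<phi>" using less_pi by (simp add: algebra_simps)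
  then have "sin (real n * \<phi> - pi) \<ge> 0" using phi pi_le by (intro sin_ge_zero) auto
  then show ?thesis by (simp add: sin_diff)
qed

text \<open>The angle \<open>j * \<phi>\<close> lies in \<open>[\<phi>, pi - \<phi>]\<close>, which
  is symmetric about \<open>pi / 2\<close>; there the sine is least at the ends.\<close>

lemma sin_phi_le_sin:
  assumes "0 < j" "j + 1 < n"
  shows "sin \<phi> \<le> sin (real j * \<phi>)"
proof -
  have lo: "\<phi> \<le> real j * \<phi>" using assms phi by simp
  have "real (j + 1) * \<phi> \<le> (real n - 1) * \<phi>" using assms phi by (intro mult_right_mono) auto
  then have hi: "real j * \<phi> < pi - \<phi>" using less_pi by (simp add: algebra_simps)
  show ?thesis
  proof (cases "real j * \<phi> \<le> pi / 2")
    case True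
    then show ?thesis using lo phi by (intro sin_monotone_2pi_le) auto
  next
    case False
    then have "sin \<phi> \<le> sin (pi - real j * \<phi>)"
      using hi phi by (intro sin_monotone_2pi_le) auto
    then show ?thesis by simp
  qed
qed

text \<open>The first sine is at least \<open>sin \<phi>\<close>, and the power of
  \<open>- s\<close> costs at most \<open>s * sin \<phi>\<close> because
  \<open>s \<le> 1\<close>.\<close>

lemma cubic_sol_pos:
  assumes s: "0 \<le> s" "s \<le> 1" and k: "2 \<le> k" "k < n"
  shows "cubic_sol s \<phi> k > 0"
proof -
  have "sin \<phi> \<le> sin (real (k - 1) * \<phi>)" using k by (intro sin_phi_le_sin) auto
  then have 1: "sin \<phi> \<le> sin ((real k - 1) * \<phi>)" using k by (simp add: of_nat_diff)
  have "\<bar>(- s) ^ k\<bar> = s ^ k" using s by (simp add: power_abs)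
  also have "\<dots> \<le> s ^ 1" using s k by (intro power_decreasing) auto
  finally have "- s \<le> (- s) ^ k" unfolding power_one_right by linarith
  then have 2: "- s * sin \<phi> \<le> (- s) ^ k * sin \<phi>"
    using sin_phi_pos by (intro mult_right_mono) auto
  have 3: "sin (real k * \<phi>) > 0" using k by (intro sin_pos) auto
  \<comment> \<open>At \<open>s = 0\<close> only the first summand is positive, at
    \<open>s = 1\<close> only the second.\<close>
  have "0 < (1 - s) * sin \<phi> + s * sin (real k * \<phi>)"
  proof (cases "s = 0")
    case False
    then show ?thesis using s 3 sin_phi_pos by (intro add_nonneg_pos) auto
  qed (use sin_phi_pos in simp)
  also have "\<dots> \<le> cubic_sol s \<phi> k"
    using 1 2 by (simp add: cubic_sol_def algebra_simps)
  finally show ?thesis .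
qed

lemma le_n_up_quad:
  assumes "r > 0"
  shows "enat n \<le> n_up (quad r \<phi>)"
proof (rule le_n_up)
  show "(\<lambda>k. r ^ k * sin (real k * \<phi> + 0)) \<in> rec_space (quad r \<phi>)"
    by (rule sin_in_rec_space_quad)
  show "0 < r ^ i * sin (real i * \<phi> + 0)" if "degree (quad r \<phi>) - 1 \<le> i" "i < n" for i
    using that assms sin_pos[of i] by simp
qed (use n_ge_3 in auto)

text \<open>Serves for the bound \<open>m = n\<close> and, when the solution is still positive at
  \<open>n\<close>, for \<open>m = n + 1\<close>; \<open>c \<le> r\<close> places
  \<open>c / r\<close> in \<open>[0, 1]\<close>.\<close>

lemma le_n_up_cubic:
  assumes "r > 0" "0 \<le> c" "c \<le> r" and m: "n \<le> m" "m \<le> n + 1"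
    and pos: "m = n + 1 \<Longrightarrow> cubic_sol (c / r) \<phi> n > 0"
  shows "enat m \<le> n_up (cubic c r \<phi>)"
proof (rule le_n_up)
  show "(\<lambda>k. r ^ k * cubic_sol (c / r) \<phi> k) \<in> rec_space (cubic c r \<phi>)"
    using assms by (intro cubic_sol_in_rec_space) auto
  show "r ^ i * cubic_sol (c / r) \<phi> i = 0" if "i < degree (cubic c r \<phi>) - 1" for i
  proof -
    have "i = 0 \<or> i = 1" using that by auto
    then show ?thesis by (auto simp: cubic_sol_def)
  qed
  show "0 < r ^ i * cubic_sol (c / r) \<phi> i" if "degree (cubic c r \<phi>) - 1 \<le> i" "i < m" for i
  proof -
    consider "i < n" | "i = n" "m = n + 1" using \<open>i < m\<close> m by linarith
    then have "cubic_sol (c / r) \<phi> i > 0"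
      using that assms pos by cases (auto intro!: cubic_sol_pos)
    then show ?thesis using assms by simp
  qed
qed (use n_ge_3 m in auto)

text \<open>The outer coefficients are positive because their angles lie below \<pi>; the middle one
  contains \<open>sin (n * \<phi>) \<le> 0\<close> with a minus sign.\<close>

lemma trinom_nonneg:
  assumes "r > 0" and j: "0 < j" "j < n"
  shows "trinom r \<phi> j (n - j) \<in> R_plus_poly" "trinom r \<phi> j (n - j) \<noteq> 0"
    "degree (trinom r \<phi> j (n - j)) \<le> n"
proof -
  let ?f = "trinom r \<phi> j (n - j)"
  have sin: "sin (real (n - j) * \<phi>) > 0" "sin (real j * \<phi>) > 0"
    using j by (intro sin_pos; simp)+
  have coeff: "coeff ?f i = (if i = 0 then r ^ n * sin (real (n - j) * \<phi>) else 0)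
      - (if i = j then r ^ (n - j) * sin (real n * \<phi>) else 0)
      + (if i = n then sin (real j * \<phi>) else 0)" for i
    using j by (auto simp: trinom_def)
  show "?f \<in> R_plus_poly"
    using sin sin_n_le_0 assms by (auto simp: R_plus_poly_def coeff mult_le_0_iff)
  show "degree ?f \<le> n" using j by (intro degree_le) (auto simp: coeff)
  have "coeff ?f n \<noteq> 0" using sin j by (simp add: coeff)
  then show "?f \<noteq> 0" by auto
qed

lemma poly_trinom_minus:
  assumes "r > 0" and j: "0 < j" "j < n"
  shows "poly (trinom r \<phi> j (n - j)) (- c) =
    r ^ n * (sin (real (n - j) * \<phi>) - (- (c / r)) ^ j * sin (real n * \<phi>)
      + (- (c / r)) ^ n * sin (real j * \<phi>))"
proof -
  have 1: "(- c) ^ i = r ^ i * (- (c / r)) ^ i" for i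
    using assms by (simp flip: power_mult_distrib)
  have 2: "r ^ n = r ^ (n - j) * r ^ j"
    using j by (simp flip: power_add)
  show ?thesis
    using j unfolding trinom_def by (simp add: poly_monom 1 2 algebra_simps)
qed

lemma deg_plus_quad_le: "r > 0 \<Longrightarrow> deg_plus (quad r \<phi>) \<le> enat n"
  using deg_plus_le[of "trinom r \<phi> 1 (n - 1)" "quad r \<phi>"] trinom_nonneg[of r 1]
    quad_dvd_trinom[of r \<phi> 1 "n - 1"] n_ge_3
  by (auto intro: order_trans)

lemma deg_plus_cubic_le:
  assumes "r > 0" "c \<ge> 0"
  shows "deg_plus (cubic c r \<phi>) \<le> enat (n + 1)"
proof -
  let ?f = "trinom r \<phi> 1 (n - 1)"
  have f: "?f \<in> R_plus_poly" "?f \<noteq> 0" "degree ?f \<le> n"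
    using trinom_nonneg[of r 1] assms n_ge_3 by auto
  have "deg_plus (cubic c r \<phi>) \<le> enat (degree ([:c, 1:] * ?f))"
    using f assms
    by (intro deg_plus_le R_plus_poly_mult linear_in_R_plus_poly)
      (auto simp: cubic_def simp del: mult_pCons_left intro: mult_dvd_mono quad_dvd_trinom)
  also have "degree ([:c, 1:] * ?f) \<le> n + 1"
    using f degree_mult_le[of "[:c, 1:]" ?f] by simp
  finally show ?thesis by simp
qed

text \<open>Every multiple of the cubic is one of \<open>quad r \<phi>\<close>, so the bound for the
  quadratic carries over.\<close>

lemma le_deg_plus_cubic:
  assumes "r > 0"
  shows "enat n \<le> deg_plus (cubic c r \<phi>)"
proof -
  have "enat n \<le> n_up (quad r \<phi>)" using assms by (rule le_n_up_quad)
  also have "\<dots> \<le> deg_plus (quad r \<phi>)" by (simp add: n_up_le_deg_plus)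
  also have "\<dots> \<le> deg_plus (cubic c r \<phi>)" by (intro deg_plus_mono quad_dvd_cubic)
  finally show ?thesis .
qed

text \<open>The value of \<open>trinom r \<phi> 1 (n - 1)\<close> at \<open>- c\<close> is a positive multiple of \<open>cubic_sol (c / r) \<phi> n\<close>.
  If it is nonpositive, a nonnegative combination with a trinomial that is nonnegative at \<open>- c\<close>
  vanishes there.\<close>

lemma deg_plus_cubic_le_n:
  assumes "r > 0" "0 \<le> c" "c \<le> r" and sol: "cubic_sol (c / r) \<phi> n \<le> 0"
  shows "deg_plus (cubic c r \<phi>) \<le> enat n"
proof -
  define s where "s = c / r"
  have s: "0 \<le> s" "s \<le> 1" using assms by (auto simp: s_def)
  define f where "f = trinom r \<phi> 1 (n - 1)"
  have n3: "n \<ge> 3" by (rule n_ge_3)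
  have "poly f (- c) = r ^ n * cubic_sol s \<phi> n"
    using n3 unfolding f_def by (subst poly_trinom_minus[OF \<open>r > 0\<close>])
      (auto simp: cubic_sol_def s_def of_nat_diff)
  then have fc: "poly f (- c) \<le> 0"
    using assms by (simp add: s_def mult_le_0_iff)
  have f: "f \<in> R_plus_poly" "f \<noteq> 0" "degree f \<le> n" "quad r \<phi> dvd f"
    using trinom_nonneg[of r 1] assms n3 by (auto simp: f_def quad_dvd_trinom)
  \<comment> \<open>An even \<open>j\<close> makes the middle term of
    \<open>trinom r \<phi> j (n - j)\<close> nonnegative at \<open>- c\<close>; the last condition
    says that the two outer terms together are nonnegative.\<close>
  obtain j where j: "0 < j" "j < n" "even j" "(- s) ^ n * sin (real j * \<phi>) \<ge> - sin (real (n - j) * \<phi>)"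
  proof (cases "even n")
    case True
    then have "n \<noteq> 3" by auto
    then have "2 < n" using n3 by simp
    moreover have "sin (real 2 * \<phi>) > 0" "sin (real (n - 2) * \<phi>) > 0"
      using \<open>2 < n\<close> by (intro sin_pos; simp)+
    then have "- sin (real (n - 2) * \<phi>) \<le> 0" "0 \<le> (- s) ^ n * sin (real 2 * \<phi>)"
      using True s by auto
    ultimately show ?thesis by (intro that[of 2]) auto
  next
    case False
    \<comment> \<open>For odd \<open>n\<close> and \<open>j = n - 1\<close> it remains to see that
      \<open>s^n * sin ((n - 1) * \<phi>) \<le> sin \<phi>\<close>, which holds because
      \<open>pi - (n - 1) * \<phi>\<close> lies in \<open>(0, \<phi>]\<close>.\<close>
    have "sin (real (n - 1) * \<phi>) = sin (real n * \<phi> - \<phi>)"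
      using n3 by (simp add: of_nat_diff algebra_simps)
    also have "\<dots> = sin (pi + \<phi> - real n * \<phi>)"
      by (simp add: sin_diff sin_add cos_add)
    also have "\<dots> \<le> sin \<phi>"
      using phi pi_le less_pi by (intro sin_monotone_2pi_le) (auto simp: algebra_simps)
    finally have 1: "sin (real (n - 1) * \<phi>) \<le> sin \<phi>" .
    have 2: "sin (real (n - 1) * \<phi>) > 0" using n3 by (intro sin_pos) auto
    have "s ^ n * sin (real (n - 1) * \<phi>) \<le> 1 * sin (real (n - 1) * \<phi>)"
      using s 2 by (intro mult_right_mono power_le_one) auto
    then have "- sin (real (n - (n - 1)) * \<phi>) \<le> (- s) ^ n * sin (real (n - 1) * \<phi>)"
      using 1 n3 False by simp
    then show ?thesis using n3 False by (intro that[of "n - 1"]) auto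
  qed
  define g where "g = trinom r \<phi> j (n - j)"
  have g: "g \<in> R_plus_poly" "g \<noteq> 0" "degree g \<le> n" "quad r \<phi> dvd g"
    using trinom_nonneg[of r j] assms j by (auto simp: g_def quad_dvd_trinom)
  have "poly g (- c) = r ^ n * (sin (real (n - j) * \<phi>) - s ^ j * sin (real n * \<phi>)
      + (- s) ^ n * sin (real j * \<phi>))"
    using j unfolding g_def by (subst poly_trinom_minus[OF \<open>r > 0\<close>]) (auto simp: s_def)
  also have "\<dots> \<ge> 0"
  proof -
    have "s ^ j * sin (real n * \<phi>) \<le> 0"
      using s sin_n_le_0 by (simp add: mult_nonneg_nonpos)
    then show ?thesis using j(4) assms by (intro mult_nonneg_nonneg) auto
  qed
  finally have gc: "poly g (- c) \<ge> 0" .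
  show ?thesis
  proof (cases "poly f (- c) = 0")
    case True
    then have "deg_plus (cubic c r \<phi>) \<le> enat (degree f)"
      using f assms cos_phi_pos by (intro deg_plus_le cubic_dvdI) auto
    then show ?thesis using f by (auto intro: order_trans)
  next
    case False
    \<comment> \<open>The weights make the values at \<open>- c\<close> cancel; the second one is
      positive since \<open>poly f (- c) < 0\<close>, so \<open>h\<close> is nonzero.\<close>
    define h where "h = smult (poly g (- c)) f + smult (- poly f (- c)) g"
    have mem: "smult (poly g (- c)) f \<in> R_plus_poly" "smult (- poly f (- c)) g \<in> R_plus_poly"
      using f g fc gc by (auto intro!: R_plus_poly_smult simp del: smult_minus_left)
    have "deg_plus (cubic c r \<phi>) \<le> enat (degree h)"
    proof (intro deg_plus_le cubic_dvdI)
      show "h \<in> R_plus_poly" unfolding h_def by (intro R_plus_poly_add mem)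
      show "h \<noteq> 0" using R_plus_poly_add_eq_0_iff[OF mem] g False by (auto simp: h_def)
      show "quad r \<phi> dvd h" using f g unfolding h_def by (intro dvd_add dvd_smult)
      show "poly h (- c) = 0" by (simp add: h_def)
    qed (use assms cos_phi_pos in auto)
    also have "degree h \<le> n"
      unfolding h_def using f g
      by (intro degree_add_le) (auto intro: order_trans[OF degree_smult_le])
    finally show ?thesis by simp
  qed
qed

lemma deg_plus_cubic_le_n_up:
  assumes "r > 0" "0 \<le> c" "c \<le> r"
  shows "deg_plus (cubic c r \<phi>) \<le> n_up (cubic c r \<phi>)"
proof (cases "cubic_sol (c / r) \<phi> n \<le> 0")
  case True
  then show ?thesis
    using deg_plus_cubic_le_n[OF assms] le_n_up_cubic[OF assms, of n] by simp
next
  case False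
  then show ?thesis
    using deg_plus_cubic_le[of r c] le_n_up_cubic[OF assms, of "n + 1"] assms by simp
qed

lemma deg_plus_cubic_eq_n_iff:
  assumes "r > 0" "0 \<le> c" "c \<le> r"
  shows "deg_plus (cubic c r \<phi>) = enat n \<longleftrightarrow> cubic_sol (c / r) \<phi> n \<le> 0"
proof
  assume deg: "deg_plus (cubic c r \<phi>) = enat n"
  show "cubic_sol (c / r) \<phi> n \<le> 0"
  proof (rule ccontr)
    assume "\<not> cubic_sol (c / r) \<phi> n \<le> 0"
    then have "enat (n + 1) \<le> n_up (cubic c r \<phi>)"
      using le_n_up_cubic[OF assms, of "n + 1"] by simp
    also have "\<dots> \<le> deg_plus (cubic c r \<phi>)" by (simp add: n_up_le_deg_plus)
    finally show False using deg by simp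
  qed
qed (use deg_plus_cubic_le_n[OF assms] le_deg_plus_cubic[OF assms(1)] in \<open>simp add: antisym\<close>)

end

section \<open>Reversal and the case \<open>c > r\<close>\<close>

lemma reflect_cubic:
  assumes "c > 0" "r > 0"
  shows "reflect_poly (cubic c r \<phi>) = smult (c * r\<^sup>2) (cubic (1 / c) (1 / r) \<phi>)"
proof -
  \<comment> \<open>Reversal inverts the roots: \<open>- c\<close> becomes \<open>- 1 / c\<close>,
    and \<omega> and its conjugate become a conjugate pair of modulus \<open>1 / r\<close> with the
    same angle \<phi>.\<close>
  have 1: "reflect_poly [:c, 1:] = smult c [:1 / c, 1:]"
    using assms by (simp add: reflect_poly_pCons)
  have 2: "reflect_poly (quad r \<phi>) = smult (r\<^sup>2) (quad (1 / r) \<phi>)"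
    using assms by (simp add: quad_def reflect_poly_pCons power2_eq_square)
  show ?thesis
    unfolding cubic_def reflect_poly_mult 1 2 by (simp only: mult_smult_left mult_smult_right smult_smult mult.commute)
qed

lemma deg_plus_cubic_inverse:
  assumes "c > 0" "r > 0"
  shows "deg_plus (cubic (1 / c) (1 / r) \<phi>) = deg_plus (cubic c r \<phi>)"
proof -
  have "coeff (cubic c r \<phi>) 0 \<noteq> 0"
    using assms by (simp add: cubic_def quad_def)
  then show ?thesis
    using deg_plus_reflect[of "cubic c r \<phi>"] assms by (simp add: reflect_cubic deg_plus_smult)
qed

lemma n_down_cubic:
  assumes "c > 0" "r > 0"
  shows "n_down (cubic c r \<phi>) = n_up (cubic (1 / c) (1 / r) \<phi>)"
  using assms by (simp add: n_down_def reflect_cubic n_up_smult)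

lemma half_turn_ceiling:
  assumes "0 < \<phi>" "\<phi> < pi / 2"
  shows "half_turn \<phi> (nat \<lceil>pi / \<phi>\<rceil>)"
proof
  have pos: "0 < \<lceil>pi / \<phi>\<rceil>" using assms by simp
  show "(real (nat \<lceil>pi / \<phi>\<rceil>) - 1) * \<phi> < pi"
    using assms pos ceiling_correct[of "pi / \<phi>"] by (simp add: field_simps)
  show "pi \<le> real (nat \<lceil>pi / \<phi>\<rceil>) * \<phi>"
    using assms pos le_of_int_ceiling[of "pi / \<phi>"] by (simp add: pos_divide_le_eq del: le_of_int_ceiling)
qed (use assms in auto)

text \<open>For \<open>c > r\<close>, reversal replaces \<open>c\<close> and \<open>r\<close> by
  their reciprocals, which are in the right order, and \<open>n_up\<close> by \<open>n_down\<close>.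
  The value \<open>c = 0\<close> falls under \<open>c \<le> r\<close>.\<close>

lemma deg_plus_cubic:
  assumes "0 < \<phi>" "\<phi> < pi / 2" "c \<ge> 0" "r > 0"
  shows "deg_plus (cubic c r \<phi>) = max (n_up (cubic c r \<phi>)) (n_down (cubic c r \<phi>))"
proof (rule antisym)
  interpret half_turn \<phi> "nat \<lceil>pi / \<phi>\<rceil>"
    using assms by (intro half_turn_ceiling)
  show "deg_plus (cubic c r \<phi>) \<le> max (n_up (cubic c r \<phi>)) (n_down (cubic c r \<phi>))"
  proof (cases "c \<le> r")
    case True
    then show ?thesis using assms deg_plus_cubic_le_n_up[of r c] by (simp add: le_max_iff_disj)
  next
    case False
    then have "deg_plus (cubic (1 / c) (1 / r) \<phi>) \<le> n_up (cubic (1 / c) (1 / r) \<phi>)"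
      using assms by (intro deg_plus_cubic_le_n_up) (auto simp: field_simps)
    then show ?thesis
      using False assms deg_plus_cubic_inverse[of c r \<phi>] n_down_cubic[of c r \<phi>]
      by (simp add: le_max_iff_disj)
  qed
qed (simp add: n_up_le_deg_plus n_down_le_deg_plus)

lemma deg_plus_quad:
  assumes "0 < \<phi>" "\<phi> < pi / 2" "r > 0"
  shows "deg_plus (quad r \<phi>) = max (n_up (quad r \<phi>)) (n_down (quad r \<phi>))"
proof (rule antisym)
  interpret half_turn \<phi> "nat \<lceil>pi / \<phi>\<rceil>"
    using assms by (intro half_turn_ceiling)
  show "deg_plus (quad r \<phi>) \<le> max (n_up (quad r \<phi>)) (n_down (quad r \<phi>))"
    using deg_plus_quad_le le_n_up_quad assms by (meson le_max_iff_disj order_trans)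
qed (simp add: n_up_le_deg_plus n_down_le_deg_plus)

subsection \<open>Factorization of positive polynomials\<close>

lemma lead_coeff_D_plus_pos:
  assumes "p \<in> D_plus" "p \<noteq> 0"
  shows "lead_coeff p > 0"
proof (rule ccontr)
  assume "\<not> lead_coeff p > 0"
  then have "lead_coeff (- p) > 0" using assms(2) by (simp add: less_le)
  from poly_pinfty_gt_lc[OF this] obtain N where N: "\<And>x. x \<ge> N \<Longrightarrow> poly (- p) x \<ge> lead_coeff (- p)"
    by blast
  have "poly p (max N 1) > 0" using assms by (auto simp: D_plus_def)
  then show False using N[of "max N 1"] \<open>lead_coeff (- p) > 0\<close> by simp
qed

lemma D_plus_poly_0_nonneg:
  assumes "p \<in> D_plus"
  shows "poly p 0 \<ge> 0"
proof (cases "p = 0")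
  case False
  have "(poly p \<longlongrightarrow> poly p 0) (at_right 0)"
    using poly_isCont[of 0 p] by (simp add: isCont_def filterlim_at_split)
  moreover have "eventually (\<lambda>x. poly p x \<ge> 0) (at_right 0)"
    using eventually_at_right_less[of "0 :: real"] 
    by eventually_elim (use assms False in \<open>auto simp: D_plus_def intro: less_imp_le\<close>)
  ultimately show ?thesis by (rule tendsto_lowerbound) simp
qed simp

text \<open>If the linear coefficient is negative, positivity forces nonreal roots; their real part
  is positive, so their argument is acute.\<close>

lemma D_plus_degree_2_cases:
  assumes p: "p \<in> D_plus" "degree p = 2"
  shows "p \<in> R_plus_poly \<or> (\<exists>a r \<phi>. a > 0 \<and> r > 0 \<and> 0 < \<phi> \<and> \<phi> < pi / 2 \<and> p = smult a (quad r \<phi>))"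
proof -
  define a b c where "a = coeff p 2" and "b = coeff p 1" and "c = coeff p 0"
  have p_eq: "p = [:c, b, a:]"
  proof (rule poly_eqI)
    fix i show "coeff p i = coeff [:c, b, a:] i"
      using p(2) coeff_eq_0[of p i]
      by (auto simp: a_def b_def c_def coeff_pCons numeral_2_eq_2 split: nat.splits)
  qed
  have a: "a > 0" using lead_coeff_D_plus_pos[of p] p by (force simp: a_def)
  have c: "c \<ge> 0" using D_plus_poly_0_nonneg[OF p(1)] by (simp add: p_eq)
  show ?thesis
  proof (cases "b \<ge> 0")
    case True
    then have "p \<in> R_plus_poly"
      using a c by (auto simp: p_eq R_plus_poly_def coeff_pCons split: nat.splits)
    then show ?thesis ..
  next
    case False
    \<comment> \<open>This is the vertex, where positivity says that the discriminant is
      negative.\<close>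
    then have "- b / (2 * a) > 0" using a by (intro divide_pos_pos) auto
    then have "poly p (- b / (2 * a)) > 0"
      using p unfolding D_plus_def by fastforce
    also have "poly p (- b / (2 * a)) = (4 * a * c - b\<^sup>2) / (4 * a)"
      using a by (simp add: p_eq field_simps power2_eq_square)
    finally have disc: "b\<^sup>2 < 4 * a * c" using a by (simp add: zero_less_divide_iff)
    have "4 * a * c > 0" using disc by (smt (verit) zero_le_power2)
    then have "c > 0" using a by (simp add: zero_less_mult_iff)
    \<comment> \<open>Comparing coefficients with \<open>smult a (quad r \<phi>)\<close> determines
      \<open>r\<close> and \<open>t = cos \<phi>\<close>; the discriminant bound becomes
      \<open>t\<^sup>2 < 1\<close>.\<close>
    define r where "r = sqrt (c / a)"
    have r: "r > 0" "r\<^sup>2 = c / a" using \<open>c > 0\<close> a by (auto simp: r_def)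
    define t where "t = - b / (2 * a * r)"
    have "t > 0" using False a r unfolding t_def by (intro divide_pos_pos) auto
    have "t\<^sup>2 = b\<^sup>2 / (4 * a * c)"
      using a by (simp add: t_def power_divide power_mult_distrib r power2_eq_square[of a])
    then have "t\<^sup>2 < 1"
      using disc a \<open>c > 0\<close> by simp
    then have "t < 1" by (simp add: abs_square_less_1)
    have phi: "0 < arccos t" "arccos t < pi / 2" "cos (arccos t) = t"
      using arccos_lt_bounded[of t] arccos_less_arccos[of 0 t] \<open>t > 0\<close> \<open>t < 1\<close> by auto
    have "b = - (a * (2 * r * t))" using a r by (simp add: t_def)
    then have "p = smult a (quad r (arccos t))"
      using a r by (simp add: p_eq quad_def phi)
    then show ?thesis using a r phi by blast
  qed
qed

lemma odd_degree_real_root: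
  fixes p :: "real poly"
  assumes "odd (degree p)"
  shows "\<exists>x. poly p x = 0"
proof -
  have pos: "\<exists>x. poly q x = 0" if odd: "odd (degree q)" and lc: "lead_coeff q > 0" for q :: "real poly"
  proof -
    obtain N where N: "\<And>x. x \<ge> N \<Longrightarrow> poly q x \<ge> lead_coeff q"
      using poly_pinfty_gt_lc[OF lc] by blast
    \<comment> \<open>In odd degree, substituting \<open>- x\<close> flips the sign of the leading
      coefficient, so \<open>q\<close> is negative far to the left.\<close>
    have "lead_coeff (- pcompose q [:0, -1:]) = lead_coeff q"
      using odd by (simp add: lead_coeff_comp)
    then obtain M where M: "\<And>x. x \<ge> M \<Longrightarrow> - poly q (- x) \<ge> lead_coeff q"
      using poly_pinfty_gt_lc[of "- pcompose q [:0, -1:]"] lc by (auto simp: poly_pcompose)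
    have "poly q (- max M 1) < 0" "poly q (max N 1) > 0"
      using N[of "max N 1"] M[of "max M 1"] lc by auto
    then show ?thesis using poly_IVT_pos[of "- max M 1" "max N 1" q] by force
  qed
  show ?thesis
  proof (cases "lead_coeff p > 0")
    case False
    have "p \<noteq> 0" using assms by auto
    then have "lead_coeff (- p) > 0" using False by (simp add: less_le)
    then show ?thesis using pos[of "- p"] assms by simp
  qed (use pos assms in blast)
qed

text \<open>A cubic outside \<open>R_plus_poly\<close> has a real root \<open>- c \<le> 0\<close>.
  The quadratic cofactor is again positive on the positive axis and again outside
  \<open>R_plus_poly\<close>, so it is a multiple of some \<open>quad r \<phi>\<close> with acute
  \<phi>.\<close>

lemma deg_plus_eq_max:
  assumes p: "p \<in> D_plus" "degree p \<in> {2, 3}"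
  shows "deg_plus p = max (n_up p) (n_down p)"
proof (cases "p \<in> R_plus_poly")
  case True
  then show ?thesis using p by (intro deg_plus_R_plus_poly) auto
next
  case False
  show ?thesis
  proof (cases "degree p = 2")
    case True
    then show ?thesis
      using D_plus_degree_2_cases[OF p(1)] False deg_plus_quad
      by (auto simp: deg_plus_smult n_up_smult n_down_smult)
  next
    case deg: False
    then have deg: "degree p = 3" using p by simp
    have "\<exists>x. poly p x = 0"
      by (rule odd_degree_real_root) (simp add: deg)
    then obtain x where x: "poly p x = 0" ..
    define c where "c = - x"
    have "\<not> x > 0" using p(1) x deg by (auto simp: D_plus_def)
    then have c: "c \<ge> 0" by (simp add: c_def)
    have "[:c, 1:] dvd p" using x by (simp add: c_def poly_eq_0_iff_dvd)
    then obtain q where pq: "p = [:c, 1:] * q" by (elim dvdE)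
    then have "q \<noteq> 0" using deg by auto
    then have "degree q = 2" using deg unfolding pq by (subst (asm) degree_mult_eq) auto
    moreover have "q \<in> D_plus"
    proof -
      have "poly q y > 0" if "y > 0" for y
      proof -
        have "poly p y > 0" using that p(1) deg by (auto simp: D_plus_def)
        then show ?thesis using that c by (simp add: pq zero_less_mult_iff del: mult_pCons_left)
      qed
      then show ?thesis by (simp add: D_plus_def)
    qed
    moreover have "q \<notin> R_plus_poly"
      using False R_plus_poly_mult[OF linear_in_R_plus_poly[OF c]] pq by blast
    ultimately obtain a r \<phi> where "a > 0" "r > 0" "0 < \<phi>" "\<phi> < pi / 2" "q = smult a (quad r \<phi>)"
      using D_plus_degree_2_cases by blast
    moreover from this have "p = smult a (cubic c r \<phi>)"
      by (simp add: pq cubic_def del: mult_pCons_left)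
    ultimately show ?thesis
      using deg_plus_cubic[of \<phi> c r] c by (simp add: deg_plus_smult n_up_smult n_down_smult)
  qed
qed

section \<open>The criterion in terms of \<epsilon> and \<open>s\<close>\<close>

lemma (in half_turn) cubic_sol_le_0_iff:
  "cubic_sol s \<phi> n \<le> 0 \<longleftrightarrow>
    sin (\<phi> - (real n * \<phi> - pi)) \<le> s * sin (real n * \<phi> - pi) + (- 1) ^ (n + 1) * s ^ n * sin \<phi>"
proof -
  \<comment> \<open>With \<open>\<epsilon> = n * \<phi> - pi\<close>, the two angles are
    \<open>pi - (\<phi> - \<epsilon>)\<close> and \<open>pi + \<epsilon>\<close>.\<close>
  have 1: "sin ((real n - 1) * \<phi>) = sin (\<phi> - (real n * \<phi> - pi))"
    by (simp add: left_diff_distrib sin_diff sin_add cos_diff)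
  have 2: "sin (real n * \<phi>) = - sin (real n * \<phi> - pi)"
    by (simp add: sin_diff)
  have 3: "(- s) ^ n = (- 1) ^ n * s ^ n"
    by (simp flip: power_mult_distrib)
  show ?thesis unfolding cubic_sol_def 1 2 3 by auto
qed

text \<open>Taking reciprocals of \<open>c\<close> and \<open>r\<close> preserves
  \<open>deg_plus\<close> and turns \<open>c / r\<close> into \<open>r / c\<close>, so the quotient
  that is at most 1 can be used.\<close>

lemma (in half_turn) deg_plus_cubic_eq_n_iff_min:
  assumes "c > 0" "r > 0"
  shows "deg_plus (cubic c r \<phi>) = enat n \<longleftrightarrow> cubic_sol (min (c / r) (r / c)) \<phi> n \<le> 0"
proof (cases "c \<le> r")
  case True
  then have "c / r \<le> 1" "1 \<le> r / c" using assms by auto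
  then have "min (c / r) (r / c) = c / r" by simp
  then show ?thesis using deg_plus_cubic_eq_n_iff[of r c] True assms by simp
next
  case False
  then have "1 \<le> c / r" "r / c \<le> 1" using assms by auto
  then have "min (c / r) (r / c) = r / c" by simp
  then show ?thesis
    using deg_plus_cubic_eq_n_iff[of "1 / r" "1 / c"] False assms
    by (simp add: deg_plus_cubic_inverse frac_le)
qed

text \<open>The product and the sum of \<omega> and its conjugate are \<open>r\<^sup>2\<close> and
  \<open>2 * r * cos \<phi>\<close>; the embedding of the reals is injective on
  coefficients.\<close>

lemma map_poly_eq_cubic:
  assumes "\<omega> = complex_of_real r * (complex_of_real (cos \<phi>) + \<i> * complex_of_real (sin \<phi>))"
    and "map_poly complex_of_real p = [:complex_of_real c, 1:] * [:- \<omega>, 1:] * [:- cnj \<omega>, 1:]"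
  shows "p = cubic c r \<phi>"
proof -
  have norm: "\<omega> * cnj \<omega> = complex_of_real (r\<^sup>2)"
    unfolding complex_mult_cnj assms(1)
    by (simp add: power_mult_distrib flip: distrib_left)
  have tr: "\<omega> + cnj \<omega> = complex_of_real (2 * r * cos \<phi>)"
    unfolding complex_add_cnj assms(1) by simp
  have "[:- \<omega>, 1:] * [:- cnj \<omega>, 1:] = [:\<omega> * cnj \<omega>, - (\<omega> + cnj \<omega>), 1:]"
    by simp
  also have "\<dots> = [:complex_of_real (r\<^sup>2), - complex_of_real (2 * r * cos \<phi>), 1:]"
    unfolding norm tr ..
  finally have "map_poly complex_of_real p =
      [:complex_of_real c, 1:] * [:complex_of_real (r\<^sup>2), - complex_of_real (2 * r * cos \<phi>), 1:]"
    unfolding assms(2) mult.assoc by simp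
  also have "\<dots> = map_poly complex_of_real (cubic c r \<phi>)"
    by (simp add: cubic_def quad_def map_poly_pCons)
  finally have "complex_of_real (coeff p i) = complex_of_real (coeff (cubic c r \<phi>) i)" for i
    by (metis coeff_map_poly of_real_0)
  then show ?thesis by (intro poly_eqI) simp
qed

theorem theorem2p6:
  shows "(\<forall>p. p \<in> D_plus \<and> degree p \<in> {2, 3} \<longrightarrow> deg_plus p = max (n_up p) (n_down p)) \<and>
    (\<forall>(p :: real poly) (\<omega> :: complex) (r :: real) (c :: real) (\<phi> :: real)
        (n :: nat) (\<epsilon> :: real) (s :: real).
       c > 0 \<and> r > 0 \<and> 0 < \<phi> \<and> \<phi> < pi / 2 \<and>
       \<omega> = complex_of_real r * (complex_of_real (cos \<phi>) + \<i> * complex_of_real (sin \<phi>)) \<and>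
       map_poly complex_of_real p = [:complex_of_real c, 1:] * [:- \<omega>, 1:] * [:- cnj \<omega>, 1:] \<and>
       n = nat \<lceil>pi / \<phi>\<rceil> \<and> \<epsilon> = real n * \<phi> - pi \<and> s = min (c / r) (r / c) \<longrightarrow>
       0 \<le> \<epsilon> \<and> \<epsilon> < \<phi> \<and>
       enat n \<le> deg_plus p \<and> deg_plus p \<le> enat (n + 1) \<and>
       (deg_plus p = enat n \<longleftrightarrow>
          sin (\<phi> - \<epsilon>) \<le> s * sin \<epsilon> + (-1) ^ (n + 1) * s ^ n * sin \<phi>))"
proof (rule conjI)
  show "\<forall>p. p \<in> D_plus \<and> degree p \<in> {2, 3} \<longrightarrow> deg_plus p = max (n_up p) (n_down p)"
    using deg_plus_eq_max by blast
next
  show "\<forall>(p :: real poly) (\<omega> :: complex) (r :: real) (c :: real) (\<phi> :: real)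
        (n :: nat) (\<epsilon> :: real) (s :: real).
       c > 0 \<and> r > 0 \<and> 0 < \<phi> \<and> \<phi> < pi / 2 \<and>
       \<omega> = complex_of_real r * (complex_of_real (cos \<phi>) + \<i> * complex_of_real (sin \<phi>)) \<and>
       map_poly complex_of_real p = [:complex_of_real c, 1:] * [:- \<omega>, 1:] * [:- cnj \<omega>, 1:] \<and>
       n = nat \<lceil>pi / \<phi>\<rceil> \<and> \<epsilon> = real n * \<phi> - pi \<and> s = min (c / r) (r / c) \<longrightarrow>
       0 \<le> \<epsilon> \<and> \<epsilon> < \<phi> \<and>
       enat n \<le> deg_plus p \<and> deg_plus p \<le> enat (n + 1) \<and>
       (deg_plus p = enat n \<longleftrightarrow>
          sin (\<phi> - \<epsilon>) \<le> s * sin \<epsilon> + (-1) ^ (n + 1) * s ^ n * sin \<phi>)"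
  proof (intro allI impI, elim conjE)
    fix p :: "real poly" and \<omega> :: complex and r c \<phi> \<epsilon> s :: real and n :: nat
    assume pos: "c > 0" "r > 0" "0 < \<phi>" "\<phi> < pi / 2"
      and p: "\<omega> = complex_of_real r * (complex_of_real (cos \<phi>) + \<i> * complex_of_real (sin \<phi>))"
        "map_poly complex_of_real p = [:complex_of_real c, 1:] * [:- \<omega>, 1:] * [:- cnj \<omega>, 1:]"
      and n: "n = nat \<lceil>pi / \<phi>\<rceil>" and eps: "\<epsilon> = real n * \<phi> - pi" and s: "s = min (c / r) (r / c)"
    interpret half_turn \<phi> n
      unfolding n using pos by (intro half_turn_ceiling)
    have p_eq: "p = cubic c r \<phi>" by (rule map_poly_eq_cubic[OF p])
    have "0 \<le> \<epsilon>" "\<epsilon> < \<phi>"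
      using less_pi pi_le by (auto simp: eps algebra_simps)
    moreover have "enat n \<le> deg_plus p" "deg_plus p \<le> enat (n + 1)"
      using le_deg_plus_cubic deg_plus_cubic_le pos by (auto simp: p_eq)
    moreover have "deg_plus p = enat n \<longleftrightarrow>
        sin (\<phi> - \<epsilon>) \<le> s * sin \<epsilon> + (-1) ^ (n + 1) * s ^ n * sin \<phi>"
      unfolding p_eq eps s deg_plus_cubic_eq_n_iff_min[OF pos(1,2)] by (rule cubic_sol_le_0_iff)
    ultimately show "0 \<le> \<epsilon> \<and> \<epsilon> < \<phi> \<and>
       enat n \<le> deg_plus p \<and> deg_plus p \<le> enat (n + 1) \<and>
       (deg_plus p = enat n \<longleftrightarrow>
          sin (\<phi> - \<epsilon>) \<le> s * sin \<epsilon> + (-1) ^ (n + 1) * s ^ n * sin \<phi>)"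
      by blast
  qed
qed

end
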